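(* Let $K$ be a simplicial complex over a type $E$, let $s \in K$ be a face, let $x \in E$ with $x \notin V(K)$, and let $\sigma_s K$ be the stellar subdivision of $K$ at $s$ with barycenter $x$. Then \[ \big(K \setminus \mathrm{St}(K,s)\big) \cap \big(\mathrm{Lk}(K,s) \star \partial s \star \{x\}\big) = \mathrm{Lk}(K,s) \star \partial s = \mathrm{Lk}(\sigma_s K, \{x\}). \]
   Context: A simplicial complex over a type (set) $E$ is a set $K$ of nonempty finite subsets of $E$ (its faces) such that every nonempty subset of a face is a face. It may be empty or infinite, and not every element of $E$ need be a vertex. Intersections and unions of complexes are those of their sets of faces. $V(K) = \{x \in E \mid \{x\} \in K\}$. For a finite set $s \subseteq E$: the link is $\mathrm{Lk}(K,s) = \{t \in K \mid s \cup t \in K,\ s \cap t = \emptyset\}$; the boundary is $\partial s = \{t \subseteq s \mid t \ne \emptyset,\ t \neq s\}$; the star complement, written $K \setminus \mathrm{St}(K,s)$, is $\{t \in K \mid s \not\subseteq t\}$. For complexes $A, B$ over $E$ with disjoint vertex sets, $A \star B$ (regarded as a complex over $E$) has as faces all nonempty sets $a \cup b$ with $a \in A \cup \{\emptyset\}$, $b \in B \cup \{\emptyset\}$. For $s \in K$ and $x \in E \setminus V(K)$, the stellar subdivision of $K$ at $s$ with barycenter $x$ is $\sigma_s K = (K \setminus \mathrm{St}(K,s)) \cup (\mathrm{Lk}(K,s) \star \partial s \star \{x\})$, where $\{x\}$ denotes the complex with single face $\{x\}$. That is, the faces of $\sigma_s K$ are the faces of $K$ not containing $s$ together with all nonempty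 sets $a \cup b \cup c$ with $a \in \mathrm{Lk}(K,s) \cup \{\emptyset\}$, $b \in \partial s \cup \{\emptyset\}$, $c \in \{\emptyset, \{x\}\}$. *)

theory Defs
  imports Main
begin

text \<open>
  A complex is represented by its set of faces; the ambient set \<open>E\<close> is the type \<open>'e\<close>.
  The empty set is never a face, and the empty complex is allowed.
  Intersections and unions of complexes are those of the sets of faces.
\<close>

definition simplicial_complex :: "'e set set \<Rightarrow> bool" where
  "simplicial_complex K \<longleftrightarrow>
     (\<forall>s\<in>K. finite s \<and> s \<noteq> {} \<and> (\<forall>t. t \<subseteq> s \<and> t \<noteq> {} \<longrightarrow> t \<in> K))"

definition vertices :: "'e set set \<Rightarrow> 'e set" where
  "vertices K = {x. {x} \<in> K}"

definition link :: "'e set set \<Rightarrow> 'e set \<Rightarrow> 'e set set" where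
  "link K s = {t \<in> K. s \<union> t \<in> K \<and> s \<inter> t = {}}"

definition boundary :: "'e set \<Rightarrow> 'e set set" where
  "boundary s = {t. t \<subseteq> s \<and> t \<noteq> {} \<and> t \<noteq> s}"

definition star_complement :: "'e set set \<Rightarrow> 'e set \<Rightarrow> 'e set set" where
  "star_complement K s = {t \<in> K. \<not> s \<subseteq> t}"

text \<open>
  The join is only meaningful for complexes with disjoint vertex sets. The joins in
  \<open>stellar_subdivision\<close> below satisfy this when \<open>K\<close> is a complex, \<open>s \<in> K\<close> and
  \<open>x \<notin> vertices K\<close>: see \<open>vertices_link_boundary_disjoint\<close> and
  \<open>vertices_join_link_boundary_singleton_disjoint\<close>.
\<close>

definition join :: "'e set set \<Rightarrow> 'e set set \<Rightarrow> 'e set set"  (infixl "\<star>" 75) where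
  "A \<star> B = {a \<union> b | a b. a \<in> A \<union> {{}} \<and> b \<in> B \<union> {{}} \<and> a \<union> b \<noteq> {}}"

definition stellar_subdivision :: "'e set set \<Rightarrow> 'e set \<Rightarrow> 'e \<Rightarrow> 'e set set" where
  "stellar_subdivision K s x =
     star_complement K s \<union> (link K s \<star> boundary s \<star> {{x}})"

lemma joinI:
  assumes "a \<in> A \<union> {{}}" "b \<in> B \<union> {{}}" "t = a \<union> b" "t \<noteq> {}"
  shows "t \<in> A \<star> B"
  unfolding join_def mem_Collect_eq using assms by (intro exI[of _ a] exI[of _ b]) simp

lemma joinE:
  assumes "t \<in> A \<star> B"
  obtains a b where "t = a \<union> b" "a \<in> A \<union> {{}}" "b \<in> B \<union> {{}}" "t \<noteq> {}"
  using assms unfolding join_def mem_Collect_eq by (elim exE conjE) simp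

lemma vertices_link_boundary_disjoint:
  "vertices (link K s) \<inter> vertices (boundary s) = {}"
  by (auto simp: vertices_def link_def boundary_def)

lemma vertices_join_link_boundary_singleton_disjoint:
  assumes "simplicial_complex K" "s \<in> K" "x \<notin> vertices K"
  shows "vertices (link K s \<star> boundary s) \<inter> vertices {{x}} = {}"
proof -
  have "{x} \<notin> link K s \<star> boundary s"
  proof
    assume "{x} \<in> link K s \<star> boundary s"
    then obtain a b where ab: "{x} = a \<union> b" "a \<in> link K s \<union> {{}}" "b \<in> boundary s \<union> {{}}"
      by (rule joinE)
    then have "a = {x} \<or> b = {x}"
      by (cases "x \<in> a") blast+
    with ab have "{x} \<in> link K s \<or> {x} \<in> boundary s" by blast
    then have "{x} \<in> K"
      using assms(1,2) unfolding link_def boundary_def simplicial_complex_def by blast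
    with assms(3) show False by (simp add: vertices_def)
  qed
  then show ?thesis by (auto simp: vertices_def)
qed

lemma simplicial_complex_link:
  assumes "simplicial_complex K" shows "simplicial_complex (link K s)"
  unfolding simplicial_complex_def
proof (intro ballI conjI allI impI)
  fix t assume t: "t \<in> link K s"
  then show "finite t" "t \<noteq> {}"
    using assms by (auto simp: link_def simplicial_complex_def)
  fix u assume u: "u \<subseteq> t \<and> u \<noteq> {}"
  have "u \<in> K" using t u assms by (auto simp: link_def simplicial_complex_def)
  moreover have "s \<union> u \<in> K"
  proof -
    have "s \<union> t \<in> K" "s \<union> u \<subseteq> s \<union> t" "s \<union> u \<noteq> {}" using t u by (auto simp: link_def)
    then show ?thesis using assms unfolding simplicial_complex_def by blast
  qed
  ultimately show "u \<in> link K s" using t u by (auto simp: link_def)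
qed

lemma simplicial_complex_boundary:
  "finite s \<Longrightarrow> simplicial_complex (boundary s)"
  by (auto simp: simplicial_complex_def boundary_def intro: finite_subset)

lemma simplicial_complex_star_complement:
  "simplicial_complex K \<Longrightarrow> simplicial_complex (star_complement K s)"
  unfolding simplicial_complex_def star_complement_def by blast

lemma simplicial_complex_join:
  assumes "simplicial_complex A" "simplicial_complex B"
  shows "simplicial_complex (A \<star> B)"
  unfolding simplicial_complex_def
proof (intro ballI conjI allI impI)
  fix t assume "t \<in> A \<star> B"
  then obtain a b where ab: "t = a \<union> b" "a \<in> A \<union> {{}}" "b \<in> B \<union> {{}}" "t \<noteq> {}"
    by (rule joinE)
  then show "finite t" "t \<noteq> {}"
    using assms by (auto simp: simplicial_complex_def)
  fix u assume u: "u \<subseteq> t \<and> u \<noteq> {}"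
  have eq: "u = (u \<inter> a) \<union> (u \<inter> b)" using u ab by blast
  have ua: "u \<inter> a \<in> A \<union> {{}}"
  proof (cases "u \<inter> a = {}")
    case False
    then have "a \<in> A" "u \<inter> a \<subseteq> a" using ab(2) by auto
    with False show ?thesis using assms(1) unfolding simplicial_complex_def by blast
  qed simp
  have ub: "u \<inter> b \<in> B \<union> {{}}"
  proof (cases "u \<inter> b = {}")
    case False
    then have "b \<in> B" "u \<inter> b \<subseteq> b" using ab(3) by auto
    with False show ?thesis using assms(2) unfolding simplicial_complex_def by blast
  qed simp
  show "u \<in> A \<star> B" using joinI[OF ua ub eq] u by blast
qed

lemma simplicial_complex_Un:
  assumes "simplicial_complex A" "simplicial_complex B"
  shows "simplicial_complex (A \<union> B)"
  unfolding simplicial_complex_def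
proof (intro ballI)
  fix t assume "t \<in> A \<union> B"
  then show "finite t \<and> t \<noteq> {} \<and> (\<forall>u. u \<subseteq> t \<and> u \<noteq> {} \<longrightarrow> u \<in> A \<union> B)"
  proof
    assume "t \<in> A"
    with assms(1) show ?thesis unfolding simplicial_complex_def by blast
  next
    assume "t \<in> B"
    with assms(2) show ?thesis unfolding simplicial_complex_def by blast
  qed
qed

lemma simplicial_complex_stellar_subdivision:
  assumes "simplicial_complex K" "s \<in> K"
  shows "simplicial_complex (stellar_subdivision K s x)"
proof -
  have "finite s" using assms by (simp add: simplicial_complex_def)
  moreover have "simplicial_complex {{x}}"
    by (auto simp: simplicial_complex_def)
  ultimately have "simplicial_complex (link K s \<star> boundary s \<star> {{x}})"
    by (intro simplicial_complex_join simplicial_complex_link simplicial_complex_boundary assms)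
  with simplicial_complex_star_complement[OF assms(1)] show ?thesis
    unfolding stellar_subdivision_def by (rule simplicial_complex_Un)
qed

lemma stellar_subdivision_faces:
  "stellar_subdivision K s x = {t \<in> K. \<not> s \<subseteq> t} \<union>
     {a \<union> b \<union> c | a b c. a \<in> link K s \<union> {{}} \<and> b \<in> boundary s \<union> {{}} \<and> c \<in> {{}, {x}}
        \<and> a \<union> b \<union> c \<noteq> {}}"
proof -
  have "link K s \<star> boundary s \<star> {{x}} =
     {a \<union> b \<union> c | a b c. a \<in> link K s \<union> {{}} \<and> b \<in> boundary s \<union> {{}} \<and> c \<in> {{}, {x}}
        \<and> a \<union> b \<union> c \<noteq> {}}" (is "?L = ?R")
  proof (intro set_eqI iffI)
    fix t assume "t \<in> ?L"
    then obtain d c where dc: "t = d \<union> c" "d \<in> link K s \<star> boundary s \<union> {{}}"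
        "c \<in> {{x}} \<union> {{}}" "t \<noteq> {}"
      by (rule joinE)
    have "\<exists>a b. d = a \<union> b \<and> a \<in> link K s \<union> {{}} \<and> b \<in> boundary s \<union> {{}}"
    proof (cases "d = {}")
      case False
      with dc(2) have "d \<in> link K s \<star> boundary s" by simp
      then show ?thesis by (rule joinE) (intro exI conjI)
    qed simp
    then obtain a b where "d = a \<union> b" "a \<in> link K s \<union> {{}}" "b \<in> boundary s \<union> {{}}"
      by (elim exE conjE)
    with dc show "t \<in> ?R"
      unfolding mem_Collect_eq by (intro exI[of _ a] exI[of _ b] exI[of _ c]) auto
  next
    fix t assume "t \<in> ?R"
    then obtain a b c where abc: "t = a \<union> b \<union> c" "a \<in> link K s \<union> {{}}"
        "b \<in> boundary s \<union> {{}}" "c \<in> {{}, {x}}" "t \<noteq> {}"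
      unfolding mem_Collect_eq by (elim exE conjE) simp
    have ab: "a \<union> b \<in> link K s \<star> boundary s \<union> {{}}"
      using joinI[OF abc(2,3) refl] by (cases "a \<union> b = {}") simp_all
    have "c \<in> {{x}} \<union> {{}}" using abc(4) by simp
    from joinI[OF ab this abc(1,5)] show "t \<in> ?L" .
  qed
  then show ?thesis by (simp add: stellar_subdivision_def star_complement_def)
qed

end

theory Submission
  imports Defs
begin

text \<open>Let J be the join of the link and the boundary of \<open>s\<close>. It lies inside the
  star complement (\<open>join_link_boundary_subset_star_complement\<close>), and no face there
  contains \<open>x\<close>, as \<open>x\<close> is not a vertex of \<open>K\<close>. The cone over
  J with apex \<open>x\<close> consists of J, the apex \<open>{x}\<close> and the sets
  \<open>insert x u\<close> with \<open>u\<close> in J (\<open>join_singleton\<close>). Hence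
  meeting it with the star complement leaves J, and removing \<open>x\<close> from the faces of the
  subdivision that properly contain \<open>{x}\<close> gives J again.\<close>

lemma join_singleton:
  assumes "{} \<notin> A"
  shows "A \<star> {{x}} = insert {x} (A \<union> insert x ` A)"
  using assms by (auto simp: join_def)

lemma empty_notin_join: "{} \<notin> A \<star> B"
  by (auto simp: join_def)

lemma notin_face_if_notin_vertices:
  assumes "simplicial_complex K" "x \<notin> vertices K" "t \<in> K"
  shows "x \<notin> t"
proof
  assume "x \<in> t"
  then have "{x} \<subseteq> t" "{x} \<noteq> {}" by simp_all
  with assms(1,3) have "{x} \<in> K" unfolding simplicial_complex_def by metis
  with assms(2) show False by (simp add: vertices_def)
qed

text \<open>A face \<open>a \<union> b\<close> of the join sits inside the face
  \<open>s \<union> a\<close> of \<open>K\<close>. It misses some point of \<open>s\<close>, because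
  \<open>a\<close> is disjoint from \<open>s\<close> and \<open>b\<close> is a proper subset of
  \<open>s\<close>.\<close>

lemma join_link_boundary_subset_star_complement:
  assumes K: "simplicial_complex K" and s: "s \<in> K"
  shows "link K s \<star> boundary s \<subseteq> star_complement K s"
proof
  fix t assume "t \<in> link K s \<star> boundary s"
  then obtain a b where ab: "t = a \<union> b" "a \<in> link K s \<union> {{}}" "b \<in> boundary s \<union> {{}}" "t \<noteq> {}"
    by (rule joinE)
  \<comment> \<open>This makes \<open>b\<close> a proper subset of \<open>s\<close> even when
    \<open>b = {}\<close>.\<close>
  have "s \<noteq> {}" using K s by (auto simp: simplicial_complex_def)
  with ab(3) have b: "b \<subseteq> s" "b \<noteq> s" by (auto simp: boundary_def)
  have a: "s \<union> a \<in> K" "s \<inter> a = {}" using ab(2) s by (auto simp: link_def)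
  have "t \<subseteq> s \<union> a" using ab(1) b(1) by blast
  with K a(1) ab(4) have "t \<in> K" unfolding simplicial_complex_def by blast
  moreover have "\<not> s \<subseteq> t" using ab(1) a(2) b by blast
  ultimately show "t \<in> star_complement K s" by (simp add: star_complement_def)
qed

theorem theorem3p8:
  fixes K :: "'e set set" and s :: "'e set" and x :: 'e
  assumes "simplicial_complex K"
    and "s \<in> K"
    and "x \<notin> vertices K"
  shows "star_complement K s \<inter> (link K s \<star> boundary s \<star> {{x}}) = link K s \<star> boundary s
    \<and> link K s \<star> boundary s = link (stellar_subdivision K s x) {x}"
proof -
  let ?J = "link K s \<star> boundary s"
  have sub: "?J \<subseteq> star_complement K s"
    using assms(1,2) by (rule join_link_boundary_subset_star_complement)
  have cone: "?J \<star> {{x}} = insert {x} (?J \<union> insert x ` ?J)"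
    by (rule join_singleton[OF empty_notin_join])
  have x: "x \<notin> t" if "t \<in> star_complement K s" for t
    using notin_face_if_notin_vertices[OF assms(1,3)] that by (simp add: star_complement_def)
  have "star_complement K s \<inter> (?J \<star> {{x}}) = ?J"
  proof -
    have "{x} \<notin> star_complement K s" using x by blast
    moreover have "insert x u \<notin> star_complement K s" for u using x by blast
    ultimately show ?thesis unfolding cone using sub by auto
  qed
  moreover have "?J = link (stellar_subdivision K s x) {x}"
  proof (intro set_eqI iffI)
    fix t assume t: "t \<in> ?J"
    with sub x have "x \<notin> t" by blast
    moreover have "t \<in> stellar_subdivision K s x" "insert x t \<in> stellar_subdivision K s x"
      using t by (simp_all add: stellar_subdivision_def cone)
    ultimately show "t \<in> link (stellar_subdivision K s x) {x}"
      by (simp add: link_def)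
  next
    fix t assume "t \<in> link (stellar_subdivision K s x) {x}"
    then have t: "t \<in> stellar_subdivision K s x" "insert x t \<in> stellar_subdivision K s x" "x \<notin> t"
      by (auto simp: link_def)
    have "t \<noteq> {}"
      using t(1) simplicial_complex_stellar_subdivision[OF assms(1,2)]
      unfolding simplicial_complex_def by blast
    \<comment> \<open>A face containing \<open>x\<close> cannot come from the star complement, so it
      lies in the cone; excluding J and the apex leaves only \<open>insert x u\<close> with
      \<open>u\<close> in J.\<close>
    have "insert x t \<in> ?J \<star> {{x}}"
      using t(2) x by (auto simp: stellar_subdivision_def)
    moreover have "insert x t \<notin> ?J" using sub x by blast
    moreover have "insert x t \<noteq> {x}" using t(3) \<open>t \<noteq> {}\<close> by blast
    ultimately have "insert x t \<in> insert x ` ?J" unfolding cone by simp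
    then obtain u where u: "u \<in> ?J" "insert x t = insert x u" by (rule imageE)
    \<comment> \<open>Neither \<open>t\<close> nor \<open>u\<close> contains \<open>x\<close>, so
      \<open>x\<close> can be cancelled.\<close>
    have "x \<notin> u" using u(1) sub x by blast
    with t(3) u(2) have "t = u" by (simp add: insert_ident)
    with u(1) show "t \<in> ?J" by simp
  qed
  ultimately show ?thesis by blast
qed

end
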